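(* Let $\sigma$ be a nonnegative locally finite Borel measure on $\mathbb{R}_+=(0,+\infty)$, and let $0<q<1$. Then the equation $$-u''=\sigma u^q\ \text{ on } \mathbb{R}_+,\qquad u(0)=0,\qquad \lim_{x\to+\infty}\frac{u(x)}{x}=0,$$ understood as the equivalent integral equation $$u(x)=\int_0^{+\infty}\min(x,y)\,u(y)^q\,d\sigma(y),\quad x>0,$$ has a nontrivial solution if and only if, for every $a>0$, $$\int_0^a x\,d\sigma(x)+\int_a^{+\infty}x^q\,d\sigma(x)<+\infty. \qquad ( * )$$ Moreover, if $( * )$ holds for every $a>0$, then there exists a positive solution $u$ such that, for all $x>0$, $$C^{-1}\Big[\Big(\int_0^x y\,d\sigma(y)\Big)^{\frac1{1-q}}+\mathbf{K}\sigma(x)\Big]\le u(x)\le C\Big[\Big(\int_0^x y\,d\sigma(y)\Big)^{\frac1{1-q}}+\mathbf{K}\sigma(x)\Big],$$ where $C$ is a positive constant and $$\mathbf{K}\sigma(x)=x\Big(\int_x^{+\infty}y^q\,d\sigma(y)\Big)^{\frac1{1-q}},\quad x>0.$$ The lower bound $$u(x)\ge C^{-1}\Big[\Big(\int_0^x y\,d\sigma(y)\Big)^{\frac1{1-q}}+\mathbf{K}\sigma(x)\Big],\quad x>0,$$ holds for any nontrivial supersolution $u$.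
   Context: Solutions and supersolutions are positive in the sense that $0<u<+\infty$ $d\sigma$-a.e., and satisfy the local integrability condition $\int_0^a y\,u(y)^q\,d\sigma(y)<+\infty$ and $\int_a^{+\infty}u(y)^q\,d\sigma(y)<+\infty$ for every $a>0$. A solution satisfies $u(x)=\int_0^{+\infty}\min(x,y)u(y)^q\,d\sigma(y)$ for all $x>0$; a supersolution satisfies $u(x)\ge\int_0^{+\infty}\min(x,y)u(y)^q\,d\sigma(y)$ for all $x>0$. The kernel $\min(x,y)$ is the Green function of $u\mapsto -u''$ on $\mathbb{R}_+$ with zero boundary condition at $x=0$. *)

theory Defs
  imports "HOL-Analysis.Analysis"
begin

text \<open>
  Conventions: \<open>\<real>\<^sub>+\<close> is the measurable space \<open>restrict_space borel {0<..}\<close>, functions on it take values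
  in \<open>[0, \<infinity>]\<close> (type \<^typ>\<open>ennreal\<close>; their values outside \<open>{0<..}\<close> are never used).
  An integral from \<open>0\<close> to \<open>x\<close> is over \<open>{0<..x}\<close> and one from \<open>x\<close> to \<open>\<infinity>\<close> is over \<open>{x<..}\<close>,
  so that the two ranges partition \<open>\<real>\<^sub>+\<close> even if the measure has an atom at \<open>x\<close>.
\<close>

text \<open>Power with a positive exponent on \<open>[0, \<infinity>]\<close>, with \<open>\<infinity>\<close> raised to \<open>p\<close> equal to \<open>\<infinity>\<close>
  (only used for \<open>p > 0\<close>).\<close>

definition epow :: "ennreal \<Rightarrow> real \<Rightarrow> ennreal" where
  "epow t p = (if t = \<infinity> then \<infinity> else ennreal (enn2real t powr p))"

definition locally_finite_borel_measure :: "real measure \<Rightarrow> bool" where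
  "locally_finite_borel_measure \<sigma> \<longleftrightarrow>
     sets \<sigma> = sets (restrict_space borel {0<..}) \<and>
     (\<forall>x>0. \<exists>U. open U \<and> x \<in> U \<and> U \<subseteq> {0<..} \<and> emeasure \<sigma> U < \<infinity>)"

definition green_potential :: "real measure \<Rightarrow> real \<Rightarrow> (real \<Rightarrow> ennreal) \<Rightarrow> real \<Rightarrow> ennreal" where
  "green_potential \<sigma> q u x = (\<integral>\<^sup>+ y. ennreal (min x y) * epow (u y) q \<partial>\<sigma>)"

text \<open>Almost-everywhere positivity is what excludes the trivial solution \<open>u = 0\<close> (unless \<open>\<sigma> = 0\<close>,
  where the condition is void).\<close>

definition admissible :: "real measure \<Rightarrow> real \<Rightarrow> (real \<Rightarrow> ennreal) \<Rightarrow> bool" where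
  "admissible \<sigma> q u \<longleftrightarrow>
     u \<in> borel_measurable \<sigma> \<and>
     (AE x in \<sigma>. 0 < u x \<and> u x < \<infinity>) \<and>
     (\<forall>a>0. (\<integral>\<^sup>+ y\<in>{0<..a}. ennreal y * epow (u y) q \<partial>\<sigma>) < \<infinity> \<and>
            (\<integral>\<^sup>+ y\<in>{a<..}. epow (u y) q \<partial>\<sigma>) < \<infinity>)"

definition positive_solution :: "real measure \<Rightarrow> real \<Rightarrow> (real \<Rightarrow> ennreal) \<Rightarrow> bool" where
  "positive_solution \<sigma> q u \<longleftrightarrow> admissible \<sigma> q u \<and> (\<forall>x>0. u x = green_potential \<sigma> q u x)"

definition positive_supersolution :: "real measure \<Rightarrow> real \<Rightarrow> (real \<Rightarrow> ennreal) \<Rightarrow> bool" where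
  "positive_supersolution \<sigma> q u \<longleftrightarrow> admissible \<sigma> q u \<and> (\<forall>x>0. green_potential \<sigma> q u x \<le> u x)"

definition K_potential :: "real measure \<Rightarrow> real \<Rightarrow> real \<Rightarrow> ennreal" where
  "K_potential \<sigma> q x =
     ennreal x * epow (\<integral>\<^sup>+ y\<in>{x<..}. ennreal (y powr q) \<partial>\<sigma>) (1 / (1 - q))"

definition bounding_function :: "real measure \<Rightarrow> real \<Rightarrow> real \<Rightarrow> ennreal" where
  "bounding_function \<sigma> q x =
     epow (\<integral>\<^sup>+ y\<in>{0<..x}. ennreal y \<partial>\<sigma>) (1 / (1 - q)) + K_potential \<sigma> q x"

definition integrability_condition :: "real measure \<Rightarrow> real \<Rightarrow> real \<Rightarrow> bool" where
  "integrability_condition \<sigma> q a \<longleftrightarrow>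
     (\<integral>\<^sup>+ x\<in>{0<..a}. ennreal x \<partial>\<sigma>) + (\<integral>\<^sup>+ x\<in>{a<..}. ennreal (x powr q) \<partial>\<sigma>) < \<infinity>"

end

theory Submission
  imports Defs
begin

text \<open>
  Write \<open>S x\<close> for the integral of \<open>y d\<sigma>\<close> over \<open>{0<..x}\<close>, \<open>H x\<close> for that of \<open>y\<^sup>q d\<sigma>\<close> over
  \<open>{x<..}\<close>, \<open>p = 1 / (1 - q)\<close>, and \<open>T\<close> for the Green potential, so that the bounding function is
  \<open>B = S\<^sup>p + x H\<^sup>p\<close>.

  A supersolution \<open>u\<close> dominates \<open>G x\<close>, the integral of \<open>y u\<^sup>q d\<sigma>\<close> over \<open>{0<..x}\<close>. Hence
  \<open>y d\<sigma> \<le> G\<^sup>-\<^sup>q (y u\<^sup>q d\<sigma>) = G\<^sup>-\<^sup>q dG\<close>, whose integral over \<open>{0<..x}\<close> is at most a constant times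
  \<open>G x\<close> to the power \<open>1 - q\<close>; this bounds \<open>S\<^sup>p\<close> by \<open>u\<close>. The same argument from the right, with the
  integral of \<open>u\<^sup>q d\<sigma>\<close> over \<open>{y..}\<close>, bounds \<open>x H\<^sup>p\<close>. Finiteness of the right-hand sides is the
  integrability condition.

  Conversely, \<open>T B \<le> c B\<close> and \<open>T (S\<^sup>p) \<ge> c' S\<^sup>p\<close>, and \<open>T\<close> is homogeneous of degree \<open>q < 1\<close>, so a large
  multiple of \<open>B\<close> is a supersolution and a small multiple of \<open>S\<^sup>p\<close> a subsolution. Iterating \<open>T\<close>
  from the subsolution gives an increasing sequence whose limit is a solution between the two.
\<close>

section \<open>Powers on [0, \<infinity>]\<close>

lemma epow_ennreal: "0 \<le> r \<Longrightarrow> epow (ennreal r) p = ennreal (r powr p)"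
  by (simp add: epow_def)

lemma epow_top [simp]: "epow top p = top"
  by (simp add: epow_def)

lemma epow_0 [simp]: "epow 0 p = 0"
  by (simp add: epow_def)

lemma epow_1 [simp]: "epow t 1 = t"
  by (cases t) (simp_all add: epow_ennreal)

lemma epow_mono: "0 < p \<Longrightarrow> s \<le> t \<Longrightarrow> epow s p \<le> epow t p"
  by (cases s; cases t) (auto simp: epow_ennreal top_unique powr_mono2)

lemma epow_mult: "0 < p \<Longrightarrow> epow (s * t) p = epow s p * epow t p"
  by (cases s; cases t)
    (auto simp: epow_ennreal powr_mult ennreal_mult_top ennreal_top_mult simp flip: ennreal_mult)

lemma epow_epow: "0 < p \<Longrightarrow> 0 < r \<Longrightarrow> epow (epow t p) r = epow t (p * r)"
  by (cases t) (simp_all add: epow_ennreal powr_powr)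

lemma epow_add: "0 < p \<Longrightarrow> 0 < r \<Longrightarrow> epow t (p + r) = epow t p * epow t r"
  by (cases t) (simp_all add: epow_ennreal powr_add ennreal_mult)

lemma epow_pos_iff [simp]: "0 < epow t p \<longleftrightarrow> 0 < t"
  by (cases t) (auto simp: epow_ennreal less_le)

lemma epow_less_top_iff [simp]: "epow t p < top \<longleftrightarrow> t < top"
  by (cases t) (auto simp: epow_ennreal)

lemma epow_le_iff: 
  assumes "0 < p" shows "epow t p \<le> c \<longleftrightarrow> t \<le> epow c (1 / p)"
proof
  assume "epow t p \<le> c"
  from epow_mono[OF _ this, of "1 / p"] show "t \<le> epow c (1 / p)"
    using assms by (simp add: epow_epow)
next
  assume "t \<le> epow c (1 / p)"
  from epow_mono[OF assms this] show "epow t p \<le> c"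
    using assms by (simp add: epow_epow)
qed

text \<open>By \<open>epow_le_iff\<close> the power is one half of a Galois connection whose other
  half is the power \<open>1 / p\<close>, so it preserves suprema, infinite values included.\<close>

lemma epow_SUP: 
  assumes "0 < p" shows "epow (SUP i. f i) p = (SUP i. epow (f i) p)"
proof (rule antisym)
  show "epow (SUP i. f i) p \<le> (SUP i. epow (f i) p)"
    unfolding epow_le_iff[OF assms] SUP_le_iff
    by (auto simp flip: epow_le_iff[OF assms] intro: SUP_upper)
  show "(SUP i. epow (f i) p) \<le> epow (SUP i. f i) p"
    by (intro SUP_least epow_mono assms SUP_upper) auto
qed

text \<open>Comparing with twice the maximum treats exponents below and above 1 alike; it is applied
  with \<open>q < 1\<close> and with \<open>q / (1 - q)\<close>, which may lie on either side of
  1.\<close>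

lemma epow_add_le:
  assumes "0 < p" 
  shows "epow (s + t) p \<le> ennreal (2 powr p) * (epow s p + epow t p)"
proof -
  have "epow (s + t) p \<le> epow (2 * max s t) p"
    by (intro epow_mono assms) (simp add: mult_2 add_mono)
  also have "\<dots> = ennreal (2 powr p) * epow (max s t) p"
    using epow_ennreal[of 2 p] by (simp add: epow_mult assms)
  also have "epow (max s t) p \<le> epow s p + epow t p"
    by (auto simp: max_def)
  finally show ?thesis by (simp add: mult_left_mono)
qed

text \<open>Both factors are bounded by powers of the maximum, and the exponents add up to 1. This
  absorbs the cross terms in the estimate of the potential of \<open>B\<close>.\<close>

lemma epow_young:
  assumes "0 < q" "q < 1"
  shows "epow s q * epow t (1 - q) \<le> s + t"
proof -
  let ?m = "max s t"
  have "epow s q * epow t (1 - q) \<le> epow ?m q * epow ?m (1 - q)"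
    using assms by (intro mult_mono epow_mono) auto
  also have "\<dots> = ?m"
    using assms epow_add[of q "1 - q" ?m] by simp
  also have "\<dots> \<le> s + t"
    by (auto simp: max_def)
  finally show ?thesis .
qed

lemma borel_measurable_epow [measurable]: "(\<lambda>t. epow t p) \<in> borel_measurable borel"
  unfolding epow_def by measurable

section \<open>Accumulated mass and its sublevel sets\<close>

text \<open>Superlevel sets of a monotone function are intervals. All accumulated masses and
  potentials below get their measurability from this.\<close>

lemma borel_measurable_ennreal_mono:
  fixes f :: "real \<Rightarrow> ennreal"
  assumes "mono f"
  shows "f \<in> borel_measurable borel"
proof (rule borel_measurableI_greater)
  fix t
  have "is_interval {x. t < f x}"
    using assms unfolding is_interval_1 by (auto simp: mono_def intro: less_le_trans)
  then show "{x \<in> space borel. t < f x} \<in> sets borel"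
    by (simp add: is_interval_convex_1 real_interval_borel_measurable)
qed

text \<open>The sublevel set need not have a largest element (there may be an atom at its supremum), hence
  the exhaustion by a sequence.\<close>

lemma nn_integral_sublevel_le:
  fixes f :: "'a \<Rightarrow> ennreal" and \<phi> :: "'a \<Rightarrow> real"
  assumes [measurable]: "f \<in> borel_measurable M" "\<phi> \<in> borel_measurable M"
  defines "G \<equiv> \<lambda>y. \<integral>\<^sup>+ z\<in>{z. \<phi> z \<le> \<phi> y}. f z \<partial>M"
  shows "(\<integral>\<^sup>+ y\<in>{y. G y \<le> s}. f y \<partial>M) \<le> s"
proof -
  define g where "g t = (\<integral>\<^sup>+ z\<in>{z. \<phi> z \<le> t}. f z \<partial>M)" for t
  have g_mono: "t \<le> t' \<Longrightarrow> g t \<le> g t'" for t t'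
    unfolding g_def by (intro nn_integral_mono) (auto split: split_indicator)
  have G: "G y = g (\<phi> y)" for y
    by (simp add: G_def g_def)
  \<comment> \<open>The set \<open>{y. G y \<le> s}\<close> is the preimage of \<open>D\<close>
    under \<open>\<phi>\<close>, and \<open>D\<close> is a down-set of the real line, which reduces
    the claim to half-lines.\<close>
  define D where "D = {t. g t \<le> s}"
  have down: "t \<le> t' \<Longrightarrow> t' \<in> D \<Longrightarrow> t \<in> D" for t t'
    using g_mono[of t t'] by (auto simp: D_def)
  have "D = {} \<or> (\<exists>t::nat \<Rightarrow> real. incseq t \<and> range t \<subseteq> D \<and> D \<subseteq> (\<Union>n. {..t n}))"
  proof (cases "D = {}")
    case False
    consider "\<not> bdd_above D" | "bdd_above D" "Sup D \<in> D" | "bdd_above D" "Sup D \<notin> D" by blast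
    then show ?thesis
    proof cases
      case 1
      have "x \<in> D" for x using 1 down unfolding bdd_above_def by (meson linear)
      then have "range real \<subseteq> D" "incseq real" "D \<subseteq> (\<Union>n. {..real n})"
        by (auto simp: incseq_def real_arch_simple)
      then show ?thesis by blast
    next
      case 2
      then have "D \<subseteq> {..Sup D}" by (auto intro: cSup_upper)
      with 2 show ?thesis
        by (intro disjI2 exI[of _ "\<lambda>_. Sup D"]) (auto simp: incseq_def)
    next
      case 3
      define t where "t n = Sup D - 1 / real (Suc n)" for n
      have "incseq t" unfolding t_def incseq_def by (auto intro!: divide_left_mono)
      moreover have "t n \<in> D" for n
      proof -
        have "t n < Sup D" by (simp add: t_def)
        then obtain x where "x \<in> D" "t n < x" using False less_cSupE by blast
        then show ?thesis using down[of "t n" x] by simp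
      qed
      moreover have "\<exists>n. x \<le> t n" if "x \<in> D" for x
      proof -
        have "x < Sup D" using that 3 cSup_upper[of x D] by (cases "x = Sup D") auto
        then obtain n where "1 / real (Suc n) < Sup D - x"
          using nat_approx_posE[of "Sup D - x"] by auto
        then show ?thesis by (intro exI[of _ n]) (simp add: t_def)
      qed
      ultimately show ?thesis by (intro disjI2 exI[of _ t]) auto
    qed
  qed simp
  then show ?thesis
  proof
    assume "D = {}"
    then have "{y. G y \<le> s} = {}" by (auto simp: D_def G)
    then show ?thesis by simp
  next
    assume "\<exists>t::nat \<Rightarrow> real. incseq t \<and> range t \<subseteq> D \<and> D \<subseteq> (\<Union>n. {..t n})"
    then obtain t :: "nat \<Rightarrow> real" where t: "incseq t" "range t \<subseteq> D" "D \<subseteq> (\<Union>n. {..t n})" by blast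
    let ?f = "\<lambda>n z. f z * indicator {z. \<phi> z \<le> t n} z"
    have "(\<integral>\<^sup>+ y\<in>{y. G y \<le> s}. f y \<partial>M) \<le> (\<integral>\<^sup>+ z. (SUP n. ?f n z) \<partial>M)"
    proof (rule nn_integral_mono)
      fix z
      show "f z * indicator {y. G y \<le> s} z \<le> (SUP n. ?f n z)"
      proof (cases "G z \<le> s")
        case True
        then obtain n where "\<phi> z \<le> t n" using t(3) by (auto simp: D_def G)
        then have "f z * indicator {y. G y \<le> s} z \<le> ?f n z" using True by simp
        also have "\<dots> \<le> (SUP n. ?f n z)" by (rule SUP_upper) simp
        finally show ?thesis .
      qed simp
    qed
    also have "\<dots> = (SUP n. integral\<^sup>N M (?f n))"
      using t(1) by (intro nn_integral_monotone_convergence_SUP)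
        (auto simp: incseq_def le_fun_def split: split_indicator intro: order_trans)
    \<comment> \<open>The \<open>n\<close>-th integral is \<open>g (t n)\<close>, and
      \<open>t n\<close> lies in \<open>D\<close>.\<close>
    also have "\<dots> \<le> s"
      using t(2) by (intro SUP_least) (auto simp: D_def g_def)
    finally show ?thesis .
  qed
qed

section \<open>Dyadic summation of accumulated mass\<close>

lemma ex_dyadic_scale:
  fixes g T :: real
  assumes "0 < g" "g \<le> T"
  shows "\<exists>k. T / 2 ^ Suc k < g \<and> g \<le> T / 2 ^ k"
proof -
  obtain n where "T / g < 2 ^ n" using real_arch_pow[of 2 "T / g"] by auto
  then have "T < g * 2 ^ n" using assms by (simp add: field_simps)
  also have "\<dots> \<le> g * 2 ^ Suc n" using assms by simp
  finally have ex: "T / 2 ^ Suc n < g" by (simp add: field_simps)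
  \<comment> \<open>Minimality yields the other inequality: for \<open>k = Suc j\<close> it is the
    failure at \<open>j\<close>, and for \<open>k = 0\<close> it is the hypothesis
    \<open>g \<le> T\<close>.\<close>
  define k where "k = (LEAST n. T / 2 ^ Suc n < g)"
  have "T / 2 ^ Suc k < g" unfolding k_def by (rule LeastI[where P = "\<lambda>n. T / 2 ^ Suc n < g", OF ex])
  moreover have "g \<le> T / 2 ^ k"
  proof (cases k)
    case (Suc j)
    then show ?thesis using not_less_Least[of j "\<lambda>n. T / 2 ^ Suc n < g"] by (auto simp: k_def not_less)
  qed (use assms in simp)
  ultimately show ?thesis by blast
qed

text \<open>The sum over \<open>k\<close> of \<open>(2^-(k+1))^-q\<close> times \<open>2^-k\<close>:
  at scale \<open>k\<close> the first factor bounds \<open>G^-q\<close> and the second one the mass,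
  both normalised to \<open>T = 1\<close>.\<close>

definition dyadic_const :: "real \<Rightarrow> real" where
  "dyadic_const q = 2 powr q / (1 - 2 powr (q - 1))"

lemma dyadic_const_pos: "q < 1 \<Longrightarrow> 0 < dyadic_const q"
  by (simp add: dyadic_const_def powr_less_one)

text \<open>Formally, \<open>a \<le> G\<^sup>-\<^sup>q b\<close>, and \<open>G\<^sup>-\<^sup>q\<close> is summed over the dyadic scales of \<open>G\<close>.\<close>

lemma nn_integral_le_total_powr:
  fixes a b G :: "'a \<Rightarrow> ennreal" and q T :: real
  assumes [measurable]: "a \<in> borel_measurable M" "b \<in> borel_measurable M" "G \<in> borel_measurable M"
    and q: "0 < q" "q < 1" and "0 \<le> T"
    and sub: "\<And>s. (\<integral>\<^sup>+ y\<in>{y. G y \<le> s}. b y \<partial>M) \<le> s"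
    and GT: "\<And>y. G y \<le> ennreal T"
    and pos: "AE y in M. a y = 0 \<or> 0 < G y"
    and dom: "AE y in M. a y * epow (G y) q \<le> b y"
  shows "(\<integral>\<^sup>+ y. a y \<partial>M) \<le> ennreal (dyadic_const q * T powr (1 - q))"
proof (cases "T = 0")
  \<comment> \<open>There are no dyadic scales below \<open>T = 0\<close>, but then \<open>G\<close>
    vanishes and \<open>pos\<close> forces \<open>a = 0\<close> almost everywhere.\<close>
  case True
  with GT have "G y = 0" for y by simp
  with pos have "AE y in M. a y = 0" by simp
  then have "(\<integral>\<^sup>+ y. a y \<partial>M) = (\<integral>\<^sup>+ y. 0 \<partial>M)" by (rule nn_integral_cong_AE)
  then show ?thesis by simp
next
  case False
  with \<open>0 \<le> T\<close> have T: "0 < T" by simp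
  \<comment> \<open>\<open>c k\<close> bounds \<open>G^-q\<close> on the shell
    \<open>T / 2^(k+1) < G \<le> T / 2^k\<close>. The summands \<open>?b k\<close> enlarge the shell
    to a full sublevel set, whose mass is controlled by \<open>sub\<close>.\<close>
  define c where "c k = (T / 2 ^ Suc k) powr (- q)" for k
  let ?b = "\<lambda>k y. ennreal (c k) * (b y * indicator {y. G y \<le> ennreal (T / 2 ^ k)} y)"
  have "(\<integral>\<^sup>+ y. a y \<partial>M) \<le> (\<integral>\<^sup>+ y. (\<Sum>k. ?b k y) \<partial>M)"
  proof (rule nn_integral_mono_AE, use pos dom in eventually_elim)
    case (elim y)
    show ?case
    proof (cases "a y = 0")
      case False
      obtain g where g: "G y = ennreal g" "0 \<le> g"
        using GT[of y] by (cases "G y") (auto simp: top_unique)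
      with False elim GT[of y] T have "0 < g" "g \<le> T" by auto
      then obtain k where k: "T / 2 ^ Suc k < g" "g \<le> T / 2 ^ k"
        using ex_dyadic_scale by blast
      \<comment> \<open>Division of \<open>dom\<close> by \<open>G^q\<close>, written as
        multiplication by \<open>g^-q\<close>; this is where \<open>0 < G y\<close> enters.\<close>
      have "ennreal (g powr - q) * ennreal (g powr q) = 1"
        using \<open>0 < g\<close> by (simp flip: ennreal_mult powr_add)
      then have "a y = ennreal (g powr - q) * (a y * epow (G y) q)"
        using g by (simp add: epow_ennreal mult.commute mult.left_commute)
      also have "\<dots> \<le> ennreal (g powr - q) * b y"
        using elim by (intro mult_left_mono) auto
      also have "\<dots> \<le> ennreal (c k) * b y"
        using k q T by (intro mult_right_mono ennreal_leI) (auto simp: c_def intro!: powr_mono2')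
      also have "\<dots> = ?b k y"
        using k g by (simp add: ennreal_leI)
      also have "\<dots> \<le> (\<Sum>k. ?b k y)"
        using sum_le_suminf[of "\<lambda>k. ?b k y" "{k}"] by simp
      finally show ?thesis .
    qed simp
  qed
  also have "\<dots> = (\<Sum>k. ennreal (c k) * (\<integral>\<^sup>+ y\<in>{y. G y \<le> ennreal (T / 2 ^ k)}. b y \<partial>M))"
    by (simp add: nn_integral_suminf nn_integral_cmult)
  also have "\<dots> \<le> (\<Sum>k. ennreal (c k) * ennreal (T / 2 ^ k))"
    by (intro suminf_le mult_left_mono sub) auto
  also have "\<dots> = (\<Sum>k. ennreal (2 powr q * T powr (1 - q) * (2 powr (q - 1)) ^ k))"
  proof (rule suminf_cong)
    fix k
    have "c k * (T / 2 ^ k) = 2 powr q * T powr (1 - q) * (2 powr (q - 1)) ^ k"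
      using T by (simp add: c_def powr_divide powr_minus powr_diff powr_power field_simps
          powr_mult powr_powr mult.commute
          flip: powr_realpow powr_add)
    then show "ennreal (c k) * ennreal (T / 2 ^ k) = ennreal (2 powr q * T powr (1 - q) * (2 powr (q - 1)) ^ k)"
      using T by (simp add: c_def flip: ennreal_mult)
  qed
  also have "\<dots> = ennreal (dyadic_const q * T powr (1 - q))"
  proof (rule suminf_ennreal_eq)
    have "(\<lambda>k. (2 powr (q - 1)) ^ k) sums (1 / (1 - 2 powr (q - 1)))"
      using q by (intro geometric_sums) (simp add: powr_less_one)
    from sums_mult[OF this, of "2 powr q * T powr (1 - q)"]
    show "(\<lambda>k. 2 powr q * T powr (1 - q) * (2 powr (q - 1)) ^ k) sums (dyadic_const q * T powr (1 - q))"
      by (simp add: dyadic_const_def)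
  qed simp
  finally show ?thesis .
qed


text \<open>A form of "the integral of \<open>G^-q dG\<close> is \<open>G^(1-q) / (1-q)\<close>"
  that tolerates atoms, at the price of a different constant. The function \<open>\<phi>\<close>
  fixes the order in which the mass \<open>b\<close> is accumulated: \<open>y\<close> sweeps from
  the left, \<open>- y\<close> from the right.\<close>

lemma nn_integral_le_distribution_powr:
  fixes a b :: "'a \<Rightarrow> ennreal" and \<phi> :: "'a \<Rightarrow> real"
  assumes [measurable]: "a \<in> borel_measurable M" "b \<in> borel_measurable M" "\<phi> \<in> borel_measurable M"
    and q: "0 < q" "q < 1"
    and fin: "(\<integral>\<^sup>+ y. b y \<partial>M) < \<infinity>"
    and pos: "AE y in M. a y = 0 \<or> 0 < b y"
    and dom: "AE y in M. a y * epow (\<integral>\<^sup>+ z\<in>{z. \<phi> z \<le> \<phi> y}. b z \<partial>M) q \<le> b y"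
  shows "(\<integral>\<^sup>+ y. a y \<partial>M) \<le> ennreal (dyadic_const q) * epow (\<integral>\<^sup>+ y. b y \<partial>M) (1 - q)"
proof -
  define g where "g t = (\<integral>\<^sup>+ z\<in>{z. \<phi> z \<le> t}. b z \<partial>M)" for t
  define T where "T = enn2real (\<integral>\<^sup>+ y. b y \<partial>M)"
  have T: "0 \<le> T" "(\<integral>\<^sup>+ y. b y \<partial>M) = ennreal T"
    using fin by (auto simp: T_def)
  have "mono g"
    unfolding g_def by (intro monoI nn_integral_mono) (auto split: split_indicator)
  note [measurable] = borel_measurable_ennreal_mono[OF this]
  have sub: "(\<integral>\<^sup>+ y\<in>{y. g (\<phi> y) \<le> s}. b y \<partial>M) \<le> s" for s
    unfolding g_def by (rule nn_integral_sublevel_le) measurable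
  have "(\<integral>\<^sup>+ y. a y \<partial>M) \<le> ennreal (dyadic_const q * T powr (1 - q))"
  proof (rule nn_integral_le_total_powr[where G = "\<lambda>y. g (\<phi> y)" and b = b])
    show "g (\<phi> y) \<le> ennreal T" for y
      unfolding g_def T(2)[symmetric] by (intro nn_integral_mono) (auto split: split_indicator)
    show "(\<lambda>y. g (\<phi> y)) \<in> borel_measurable M" by measurable
    \<comment> \<open>At level 0 the sublevel bound says that \<open>b\<close> has no mass where its
      accumulated mass vanishes; by \<open>pos\<close>, \<open>a\<close> is zero there almost
      everywhere.\<close>
    have "(\<integral>\<^sup>+ y\<in>{y. g (\<phi> y) \<le> 0}. b y \<partial>M) = 0"
      using sub[of 0] by simp
    then have "AE y in M. b y * indicator {y. g (\<phi> y) \<le> 0} y = 0"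
      by (subst (asm) nn_integral_0_iff_AE) auto
    with pos show "AE y in M. a y = 0 \<or> 0 < g (\<phi> y)"
      by eventually_elim (auto simp: zero_less_iff_neq_zero split: split_indicator_asm)
  qed (use q T sub dom in \<open>auto simp: g_def\<close>)
  then show ?thesis
    using T q dyadic_const_pos[of q] by (simp add: epow_ennreal ennreal_mult)
qed

section \<open>The potentials \<open>S\<close>, \<open>H\<close> and the Green potential on the
  half-line\<close>

locale half_line_measure =
  fixes \<sigma> :: "real measure" and q :: real
  assumes sets_sigma: "sets \<sigma> = sets (restrict_space borel {0<..})"
    and q: "0 < q" "q < 1"
begin

lemma space_sigma: "space \<sigma> = {0<..}"
  using sets_eq_imp_space_eq[OF sets_sigma] by (simp add: space_restrict_space)

lemma measurable_ident_sigma [measurable]: "(\<lambda>x. x) \<in> borel_measurable \<sigma>"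
  by (simp add: measurable_cong_sets[OF sets_sigma refl] measurable_restrict_space1)

definition S :: "real \<Rightarrow> ennreal" where
  "S x = (\<integral>\<^sup>+ y\<in>{0<..x}. ennreal y \<partial>\<sigma>)"

definition H :: "real \<Rightarrow> ennreal" where
  "H x = (\<integral>\<^sup>+ y\<in>{x<..}. ennreal (y powr q) \<partial>\<sigma>)"

abbreviation p :: real where "p \<equiv> 1 / (1 - q)"

text \<open>The exponent that \<open>S\<close> and \<open>H\<close> carry once the bounding function
  is raised to the power \<open>q\<close>.\<close>

abbreviation r :: real where "r \<equiv> q / (1 - q)"

lemma p_pos: "0 < p" and r_pos: "0 < r" and p_eq: "p = r + 1" and p_mult: "p * q = r" "p * (1 - q) = 1"
    "(1 - q) * p = 1" "(1 - q) * r = q" "(q - 1) * r = - q"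
  using q by (auto simp: field_simps)

lemma S_mono: "x \<le> y \<Longrightarrow> S x \<le> S y"
  unfolding S_def by (intro nn_integral_mono) (auto split: split_indicator)

lemma H_antimono: "x \<le> y \<Longrightarrow> H y \<le> H x"
  unfolding H_def by (intro nn_integral_mono) (auto split: split_indicator)

lemma S_measurable [measurable]: "S \<in> borel_measurable borel"
  by (intro borel_measurable_ennreal_mono monoI S_mono)

lemma H_measurable [measurable]: "H \<in> borel_measurable borel"
proof -
  have [measurable]: "(\<lambda>x. H (- x)) \<in> borel_measurable borel"
    by (intro borel_measurable_ennreal_mono monoI H_antimono) simp
  have "(\<lambda>x. H (- (- x))) \<in> borel_measurable borel" by measurable
  then show ?thesis by simp
qed

lemma bounding_function_eq:
  "bounding_function \<sigma> q x = epow (S x) p + ennreal x * epow (H x) p"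
  by (simp add: bounding_function_def K_potential_def S_def H_def)

lemma bounding_function_measurable [measurable]:
  "bounding_function \<sigma> q \<in> borel_measurable borel"
  unfolding bounding_function_eq[abs_def] by measurable

lemma integrability_condition_iff: "integrability_condition \<sigma> q a \<longleftrightarrow> S a < \<infinity> \<and> H a < \<infinity>"
  by (simp add: integrability_condition_def S_def H_def)

lemma green_potential_mono:
  assumes "\<And>y. u y \<le> v y"
  shows "green_potential \<sigma> q u x \<le> green_potential \<sigma> q v x"
  unfolding green_potential_def using assms q by (intro nn_integral_mono mult_left_mono epow_mono) auto

lemma mono_green_potential: "mono (green_potential \<sigma> q u)"
  unfolding green_potential_def
  by (intro monoI nn_integral_mono mult_right_mono ennreal_leI) auto

lemma green_potential_measurable [measurable]: "green_potential \<sigma> q u \<in> borel_measurable borel"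
  by (intro borel_measurable_ennreal_mono mono_green_potential)

text \<open>\<open>ennreal\<close> truncates negative kernel values to 0. This lets the later
  iteration run over all real \<open>x\<close> instead of only over positive ones.\<close>

lemma green_potential_nonpos: "x \<le> 0 \<Longrightarrow> green_potential \<sigma> q u x = 0"
  unfolding green_potential_def by (subst nn_integral_0_iff_AE) (auto simp: min_def ennreal_neg)

lemma green_potential_cmult:
  assumes [measurable]: "u \<in> borel_measurable \<sigma>" and "0 \<le> c"
  shows "green_potential \<sigma> q (\<lambda>y. ennreal c * u y) x = ennreal (c powr q) * green_potential \<sigma> q u x"
  unfolding green_potential_def using assms(2) q
  by (subst nn_integral_cmult[symmetric]) (auto simp: epow_mult epow_ennreal mult_ac)

lemma green_potential_split:
  assumes [measurable]: "u \<in> borel_measurable \<sigma>" and "0 < x"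
  shows "green_potential \<sigma> q u x =
    (\<integral>\<^sup>+ y\<in>{0<..x}. ennreal y * epow (u y) q \<partial>\<sigma>) + ennreal x * (\<integral>\<^sup>+ y\<in>{x<..}. epow (u y) q \<partial>\<sigma>)"
proof -
  have "green_potential \<sigma> q u x = (\<integral>\<^sup>+ y. ennreal y * epow (u y) q * indicator {0<..x} y
      + ennreal x * (epow (u y) q * indicator {x<..} y) \<partial>\<sigma>)"
    unfolding green_potential_def using assms(2)
    by (intro nn_integral_cong) (auto simp: space_sigma min_def split: split_indicator)
  also have "\<dots> = (\<integral>\<^sup>+ y\<in>{0<..x}. ennreal y * epow (u y) q \<partial>\<sigma>)
      + ennreal x * (\<integral>\<^sup>+ y\<in>{x<..}. epow (u y) q \<partial>\<sigma>)"
    by (simp add: nn_integral_add nn_integral_cmult)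
  finally show ?thesis .
qed

section \<open>Lower bound for supersolutions\<close>

text \<open>The right-hand sides stay integrals instead of \<open>u x\<close>: admissibility makes
  them finite at every \<open>x\<close>, while \<open>u\<close> is only known to be finite almost
  everywhere.\<close>

lemma
  assumes u: "positive_supersolution \<sigma> q u" and x: "0 < x"
  shows S_le_supersolution: "S x \<le> ennreal (dyadic_const q) *
      epow (\<integral>\<^sup>+ y\<in>{0<..x}. ennreal y * epow (u y) q \<partial>\<sigma>) (1 - q)" (is ?S)
    and H_le_supersolution: "H x \<le> ennreal (dyadic_const q) *
      epow (\<integral>\<^sup>+ y\<in>{x<..}. epow (u y) q \<partial>\<sigma>) (1 - q)" (is ?H)
proof -
  have [measurable]: "u \<in> borel_measurable \<sigma>"
    and pos: "AE y in \<sigma>. 0 < u y"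
    and fin: "(\<integral>\<^sup>+ y\<in>{0<..x}. ennreal y * epow (u y) q \<partial>\<sigma>) < \<infinity>" "(\<integral>\<^sup>+ y\<in>{x<..}. epow (u y) q \<partial>\<sigma>) < \<infinity>"
    and super: "\<And>y. 0 < y \<Longrightarrow> green_potential \<sigma> q u y \<le> u y"
    using u x by (auto simp: positive_supersolution_def admissible_def)
  have pos': "AE y in \<sigma>. 0 < u y \<and> 0 < y"
    using pos AE_space[of \<sigma>] by eventually_elim (auto simp: space_sigma)
  show ?S
    unfolding S_def
  proof (rule nn_integral_le_distribution_powr[where \<phi> = "\<lambda>y. y"])
    show "AE y in \<sigma>. ennreal y * indicator {0<..x} y *
      epow (\<integral>\<^sup>+ z\<in>{z. z \<le> y}. ennreal z * epow (u z) q * indicator {0<..x} z \<partial>\<sigma>) q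
      \<le> ennreal y * epow (u y) q * indicator {0<..x} y"
    proof (rule AE_I2)
      fix y assume "y \<in> space \<sigma>"
      then have y: "0 < y" by (simp add: space_sigma)
      \<comment> \<open>For \<open>z \<le> y\<close> the kernel \<open>min y z\<close> is
        \<open>z\<close>, so the mass accumulated from the left is part of the potential at
        \<open>y\<close>.\<close>
      have "(\<integral>\<^sup>+ z\<in>{z. z \<le> y}. ennreal z * epow (u z) q * indicator {0<..x} z \<partial>\<sigma>) \<le> green_potential \<sigma> q u y"
        unfolding green_potential_def
        by (intro nn_integral_mono) (auto simp: min_def split: split_indicator)
      also have "\<dots> \<le> u y" using super y .
      finally show "ennreal y * indicator {0<..x} y *
        epow (\<integral>\<^sup>+ z\<in>{z. z \<le> y}. ennreal z * epow (u z) q * indicator {0<..x} z \<partial>\<sigma>) q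
        \<le> ennreal y * epow (u y) q * indicator {0<..x} y"
        using q by (auto intro!: mult_left_mono epow_mono split: split_indicator)
    qed
    show "AE y in \<sigma>. ennreal y * indicator {0<..x} y = 0 \<or> 0 < ennreal y * epow (u y) q * indicator {0<..x} y"
      using pos' by eventually_elim (auto simp: ennreal_zero_less_mult_iff split: split_indicator)
  qed (use q fin in auto)
  show ?H
    unfolding H_def
  proof (rule nn_integral_le_distribution_powr[where \<phi> = "\<lambda>y. - y"])
    show "AE y in \<sigma>. ennreal (y powr q) * indicator {x<..} y *
      epow (\<integral>\<^sup>+ z\<in>{z. - z \<le> - y}. epow (u z) q * indicator {x<..} z \<partial>\<sigma>) q
      \<le> epow (u y) q * indicator {x<..} y"
    proof (rule AE_I2)
      fix y assume "y \<in> space \<sigma>"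
      then have y: "0 < y" by (simp add: space_sigma)
      \<comment> \<open>For \<open>z \<ge> y\<close> the kernel is the constant \<open>y\<close>;
        raised to the power \<open>q\<close> it becomes the weight \<open>y^q\<close> of
        \<open>H\<close>.\<close>
      have "ennreal y * (\<integral>\<^sup>+ z\<in>{z. - z \<le> - y}. epow (u z) q * indicator {x<..} z \<partial>\<sigma>)
        \<le> green_potential \<sigma> q u y"
        unfolding green_potential_def
        by (subst nn_integral_cmult[symmetric], measurable)
          (auto intro!: nn_integral_mono simp: min_def split: split_indicator)
      also have "\<dots> \<le> u y" using super y .
      finally have "epow (ennreal y * (\<integral>\<^sup>+ z\<in>{z. - z \<le> - y}. epow (u z) q * indicator {x<..} z \<partial>\<sigma>)) q
        \<le> epow (u y) q"
        using q by (intro epow_mono)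
      then show "ennreal (y powr q) * indicator {x<..} y *
        epow (\<integral>\<^sup>+ z\<in>{z. - z \<le> - y}. epow (u z) q * indicator {x<..} z \<partial>\<sigma>) q
        \<le> epow (u y) q * indicator {x<..} y"
        using q y by (auto simp: epow_mult epow_ennreal split: split_indicator)
    qed
    show "AE y in \<sigma>. ennreal (y powr q) * indicator {x<..} y = 0 \<or> 0 < epow (u y) q * indicator {x<..} y"
      using pos' by eventually_elim (auto split: split_indicator)
  qed (use q fin in auto)
qed

lemma supersolution_integrability_condition:
  assumes u: "positive_supersolution \<sigma> q u" and x: "0 < x"
  shows "integrability_condition \<sigma> q x"
proof -
  have "(\<integral>\<^sup>+ y\<in>{0<..x}. ennreal y * epow (u y) q \<partial>\<sigma>) < \<infinity>" "(\<integral>\<^sup>+ y\<in>{x<..}. epow (u y) q \<partial>\<sigma>) < \<infinity>"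
    using u x by (auto simp: positive_supersolution_def admissible_def)
  then have "ennreal (dyadic_const q) * epow (\<integral>\<^sup>+ y\<in>{0<..x}. ennreal y * epow (u y) q \<partial>\<sigma>) (1 - q) < \<infinity>"
    "ennreal (dyadic_const q) * epow (\<integral>\<^sup>+ y\<in>{x<..}. epow (u y) q \<partial>\<sigma>) (1 - q) < \<infinity>"
    by (auto simp: ennreal_mult_less_top)
  then show ?thesis
    unfolding integrability_condition_iff
    using S_le_supersolution[OF assms] H_le_supersolution[OF assms] by (auto intro: le_less_trans)
qed

text \<open>The power \<open>p\<close> cancels the exponent \<open>1 - q\<close>, so both estimates
  become linear in the two pieces of the potential at \<open>x\<close>, and these add up to at most
  \<open>u x\<close>.\<close>

lemma bounding_function_le_supersolution:
  assumes u: "positive_supersolution \<sigma> q u" and x: "0 < x"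
  shows "bounding_function \<sigma> q x \<le> ennreal (dyadic_const q powr p) * u x"
proof -
  let ?A = "\<integral>\<^sup>+ y\<in>{0<..x}. ennreal y * epow (u y) q \<partial>\<sigma>"
  let ?B = "\<integral>\<^sup>+ y\<in>{x<..}. epow (u y) q \<partial>\<sigma>"
  let ?D = "ennreal (dyadic_const q powr p)"
  have [measurable]: "u \<in> borel_measurable \<sigma>" and super: "green_potential \<sigma> q u x \<le> u x"
    using u x by (auto simp: positive_supersolution_def admissible_def)
  have AB: "?A + ennreal x * ?B \<le> u x"
    using super x by (simp add: green_potential_split)
  have pow: "epow t p \<le> ?D * s" if "t \<le> ennreal (dyadic_const q) * epow s (1 - q)" for s t
    using epow_mono[OF p_pos that] q dyadic_const_pos[of q]
    by (simp add: epow_mult epow_epow epow_ennreal p_mult)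
  have "bounding_function \<sigma> q x \<le> ?D * ?A + ennreal x * (?D * ?B)"
    unfolding bounding_function_eq
    by (intro add_mono mult_left_mono pow S_le_supersolution H_le_supersolution assms) auto
  also have "\<dots> = ?D * (?A + ennreal x * ?B)"
    by (simp add: algebra_simps)
  also have "\<dots> \<le> ?D * u x"
    by (intro mult_left_mono AB) auto
  finally show ?thesis .
qed


section \<open>Green potentials of \<open>B\<close> and of \<open>S^p\<close>\<close>

text \<open>On the piece between \<open>y\<close> and \<open>x\<close>,
  \<open>z^q = z^(q-1) z \<le> y^(q-1) z\<close> because \<open>q - 1 < 0\<close>. Thus
  \<open>H y\<close> is controlled by quantities frozen at \<open>x\<close>.\<close>

lemma H_le:
  assumes "0 < y" "y \<le> x"
  shows "H y \<le> ennreal (y powr (q - 1)) * S x + H x"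
proof -
  have "H y \<le> (\<integral>\<^sup>+ z. ennreal (y powr (q - 1)) * (ennreal z * indicator {0<..x} z)
      + ennreal (z powr q) * indicator {x<..} z \<partial>\<sigma>)"
    unfolding H_def
  proof (rule nn_integral_mono)
    fix z
    have "z powr q \<le> y powr (q - 1) * z" if "y < z"
    proof -
      have "z powr q = z powr (q - 1) * z"
        using that assms powr_add[of z "q - 1" 1] by simp
      also have "\<dots> \<le> y powr (q - 1) * z"
        using that assms q by (intro mult_right_mono powr_mono2') auto
      finally show ?thesis .
    qed
    then show "ennreal (z powr q) * indicator {y<..} z \<le> ennreal (y powr (q - 1)) * (ennreal z * indicator {0<..x} z)
        + ennreal (z powr q) * indicator {x<..} z"
      using assms by (auto split: split_indicator simp flip: ennreal_mult intro: ennreal_leI)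
  qed
  also have "\<dots> = ennreal (y powr (q - 1)) * S x + H x"
    by (simp add: nn_integral_add nn_integral_cmult S_def H_def)
  finally show ?thesis .
qed

text \<open>The mirror image of \<open>H_le\<close>: between \<open>x\<close> and \<open>y\<close>,
  \<open>z = z^(1-q) z^q \<le> y^(1-q) z^q\<close>.\<close>

lemma S_le:
  assumes "0 < x" "x \<le> y"
  shows "S y \<le> S x + ennreal (y powr (1 - q)) * H x"
proof -
  have "S y \<le> (\<integral>\<^sup>+ z. ennreal z * indicator {0<..x} z
      + ennreal (y powr (1 - q)) * (ennreal (z powr q) * indicator {x<..} z) \<partial>\<sigma>)"
    unfolding S_def
  proof (rule nn_integral_mono)
    fix z
    have "z \<le> y powr (1 - q) * z powr q" if "x < z" "z \<le> y"
    proof -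
      have "z = z powr (1 - q) * z powr q"
        using that assms powr_add[of z "1 - q" q] by simp
      also have "\<dots> \<le> y powr (1 - q) * z powr q"
        using that assms q by (intro mult_right_mono powr_mono2) auto
      finally show ?thesis .
    qed
    then show "ennreal z * indicator {0<..y} z \<le> ennreal z * indicator {0<..x} z
      + ennreal (y powr (1 - q)) * (ennreal (z powr q) * indicator {x<..} z)"
      using assms by (auto split: split_indicator simp flip: ennreal_mult intro: ennreal_leI)
  qed
  also have "\<dots> = S x + ennreal (y powr (1 - q)) * H x"
    by (simp add: nn_integral_add nn_integral_cmult S_def H_def)
  finally show ?thesis .
qed

lemma epow_bounding_function_le:
  assumes "0 < y"
  shows "epow (bounding_function \<sigma> q y) q \<le>
    ennreal (2 powr q) * (epow (S y) r + ennreal (y powr q) * epow (H y) r)"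
  using epow_add_le[of q "epow (S y) p" "ennreal y * epow (H y) p"] q assms
  by (simp add: bounding_function_eq epow_mult epow_epow epow_ennreal)

text \<open>In \<open>y^q H(y)^r\<close> the factor \<open>y^((q-1) r) = y^-q\<close> produced by
  \<open>H_le\<close> cancels \<open>y^q\<close>. The resulting bound is free of \<open>y\<close>
  and can leave the integral over \<open>{0<..x}\<close>.\<close>

lemma epow_bounding_function_left_le:
  assumes "0 < y" "y \<le> x"
  shows "epow (bounding_function \<sigma> q y) q \<le> ennreal (2 powr q * (1 + 2 powr r)) *
    (epow (S x) r + ennreal (x powr q) * epow (H x) r)"
proof -
  let ?d = "ennreal (2 powr r)"
  have "epow (H y) r \<le> epow (ennreal (y powr (q - 1)) * S x + H x) r"
    by (intro epow_mono H_le assms r_pos)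
  also have "\<dots> \<le> ?d * (ennreal (y powr - q) * epow (S x) r + epow (H x) r)"
    using epow_add_le[OF r_pos, of "ennreal (y powr (q - 1)) * S x" "H x"] r_pos
    by (simp only: epow_mult epow_ennreal powr_ge_zero powr_powr p_mult)
  finally have "ennreal (y powr q) * epow (H y) r \<le>
      ennreal (y powr q) * (?d * (ennreal (y powr - q) * epow (S x) r + epow (H x) r))"
    by (rule mult_left_mono) simp
  also have "\<dots> = ?d * (ennreal (y powr q) * ennreal (y powr - q) * epow (S x) r + ennreal (y powr q) * epow (H x) r)"
    by (simp add: algebra_simps)
  also have "ennreal (y powr q) * ennreal (y powr - q) = 1"
    using assms by (simp flip: ennreal_mult powr_add)
  also have "?d * (1 * epow (S x) r + ennreal (y powr q) * epow (H x) r) \<le>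
      ?d * (epow (S x) r + ennreal (x powr q) * epow (H x) r)"
    using assms q by (auto intro!: mult_left_mono mult_right_mono add_mono ennreal_leI powr_mono2)
  finally have Hy: "ennreal (y powr q) * epow (H y) r \<le> ?d * (epow (S x) r + ennreal (x powr q) * epow (H x) r)" .
  have "epow (S y) r \<le> epow (S x) r"
    using assms r_pos by (intro epow_mono S_mono)
  also have "\<dots> \<le> epow (S x) r + ennreal (x powr q) * epow (H x) r"
    by simp
  finally have "epow (S y) r + ennreal (y powr q) * epow (H y) r \<le>
      (epow (S x) r + ennreal (x powr q) * epow (H x) r) + ?d * (epow (S x) r + ennreal (x powr q) * epow (H x) r)"
    using Hy by (rule add_mono)
  also have "\<dots> = (1 + ?d) * (epow (S x) r + ennreal (x powr q) * epow (H x) r)"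
    by (simp add: distrib_right)
  also have "1 + ?d = ennreal (1 + 2 powr r)"
    by (subst ennreal_plus) auto
  finally have "ennreal (2 powr q) * (epow (S y) r + ennreal (y powr q) * epow (H y) r) \<le>
      ennreal (2 powr q) * (ennreal (1 + 2 powr r) * (epow (S x) r + ennreal (x powr q) * epow (H x) r))"
    by (rule mult_left_mono) simp
  with epow_bounding_function_le[OF assms(1)] show ?thesis
    by (simp add: ennreal_mult mult.assoc)
qed

text \<open>Here \<open>S_le\<close> produces \<open>y^((1-q) r) = y^q\<close>. The only dependence
  on \<open>y\<close> left is the density of \<open>H\<close>, so integrating over
  \<open>{x<..}\<close> gives \<open>H x\<close>.\<close>

lemma epow_bounding_function_right_le:
  assumes "0 < x" "x \<le> y"
  shows "epow (bounding_function \<sigma> q y) q \<le> ennreal (2 powr q * (1 + 2 powr r)) *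
    (ennreal (x powr - q) * epow (S x) r + epow (H x) r) * ennreal (y powr q)"
proof -
  let ?d = "ennreal (2 powr r)"
  let ?W = "ennreal (x powr - q) * epow (S x) r + epow (H x) r"
  have "epow (S y) r \<le> epow (S x + ennreal (y powr (1 - q)) * H x) r"
    by (intro epow_mono S_le assms r_pos)
  also have "\<dots> \<le> ?d * (epow (S x) r + ennreal (y powr q) * epow (H x) r)"
    using epow_add_le[OF r_pos, of "S x" "ennreal (y powr (1 - q)) * H x"] r_pos
    by (simp only: epow_mult epow_ennreal powr_ge_zero powr_powr p_mult)
  also have "\<dots> \<le> ?d * (ennreal (y powr q) * ?W)"
  proof (intro mult_left_mono)
    \<comment> \<open>Since \<open>x \<le> y\<close>, the term \<open>S(x)^r\<close>, which lacks
      the weight \<open>y^q\<close>, can take it on together with \<open>x^-q\<close>.\<close>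
    have "1 \<le> y powr q * x powr - q"
      using assms q powr_mono2[of q x y] by (simp add: powr_minus field_simps)
    then have "1 * epow (S x) r \<le> ennreal (y powr q * x powr - q) * epow (S x) r"
      by (intro mult_right_mono) (simp_all add: ennreal_leI del: ennreal_1 flip: ennreal_1)
    then show "epow (S x) r + ennreal (y powr q) * epow (H x) r \<le> ennreal (y powr q) * ?W"
      by (simp add: distrib_left ennreal_mult mult.assoc)
  qed simp
  finally have Sy: "epow (S y) r \<le> ?d * (ennreal (y powr q) * ?W)" .
  have "ennreal (y powr q) * epow (H y) r \<le> ennreal (y powr q) * epow (H x) r"
    using assms r_pos by (intro mult_left_mono epow_mono H_antimono) auto
  also have "\<dots> \<le> ennreal (y powr q) * ?W"
    by (intro mult_left_mono) auto
  finally have "epow (S y) r + ennreal (y powr q) * epow (H y) r \<le> 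
      ?d * (ennreal (y powr q) * ?W) + ennreal (y powr q) * ?W"
    by (intro add_mono Sy)
  also have "\<dots> = (1 + ?d) * (ennreal (y powr q) * ?W)"
    by (simp add: distrib_right add.commute)
  also have "1 + ?d = ennreal (1 + 2 powr r)"
    by (subst ennreal_plus) auto
  finally have "ennreal (2 powr q) * (epow (S y) r + ennreal (y powr q) * epow (H y) r) \<le>
      ennreal (2 powr q) * (ennreal (1 + 2 powr r) * (ennreal (y powr q) * ?W))"
    by (rule mult_left_mono) simp
  with epow_bounding_function_le[of y] assms show ?thesis
    by (simp add: ennreal_mult mult_ac)
qed

text \<open>The potential splits at \<open>x\<close> into two halves, each at most twice
  \<open>B x\<close> up to the factor in parentheses; hence the 4.\<close>

definition potential_const :: real where
  "potential_const = 4 * (2 powr q * (1 + 2 powr r))"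

lemma potential_const_ge_1: "1 \<le> potential_const"
proof -
  have "1 * 1 \<le> 2 powr q * (1 + 2 powr r)"
    using q by (intro mult_mono ge_one_powr_ge_zero) auto
  then show ?thesis by (simp add: potential_const_def)
qed

text \<open>Each half leaves a diagonal term, \<open>S^r S = S^p\<close> or
  \<open>x H^r H = x H^p\<close>, and a cross term. The cross terms \<open>x^q H^r S\<close> and
  \<open>x^(1-q) S^r H\<close> are geometric means of \<open>S^p\<close> and \<open>x H^p\<close>
  with weights \<open>q\<close> and \<open>1 - q\<close>, so \<open>epow_young\<close> absorbs them
  into \<open>B\<close>.\<close>

lemma green_potential_bounding_function_le:
  assumes x: "0 < x"
  shows "green_potential \<sigma> q (bounding_function \<sigma> q) x \<le> ennreal potential_const * bounding_function \<sigma> q x"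
proof -
  define c where "c = ennreal (2 powr q * (1 + 2 powr r))"
  let ?B = "bounding_function \<sigma> q"
  let ?s = "epow (S x) p" and ?k = "ennreal x * epow (H x) p"
  have B: "?B x = ?s + ?k" by (rule bounding_function_eq)
  have s: "epow (S x) r * S x = ?s" and k: "epow (H x) r * H x = epow (H x) p"
    using epow_add[OF r_pos, of 1] by (simp_all add: p_eq)
  have "(\<integral>\<^sup>+ y\<in>{0<..x}. ennreal y * epow (?B y) q \<partial>\<sigma>) \<le>
    (\<integral>\<^sup>+ y. c * (epow (S x) r + ennreal (x powr q) * epow (H x) r) * (ennreal y * indicator {0<..x} y) \<partial>\<sigma>)"
    using epow_bounding_function_left_le[of _ x, folded c_def]
    by (intro nn_integral_mono) (auto simp: mult.commute intro: mult_left_mono split: split_indicator)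
  also have "\<dots> = c * (epow (S x) r + ennreal (x powr q) * epow (H x) r) * S x"
    by (simp add: nn_integral_cmult S_def)
  also have "\<dots> = c * (epow (S x) r * S x + ennreal (x powr q) * epow (H x) r * S x)"
    by (simp add: algebra_simps)
  also have "ennreal (x powr q) * epow (H x) r * S x = epow ?k q * epow ?s (1 - q)"
    using q x by (simp add: epow_mult epow_epow epow_ennreal)
  also have "\<dots> \<le> ?k + ?s"
    using q by (rule epow_young)
  also have "epow (S x) r * S x + (?k + ?s) \<le> 2 * ?B x"
    unfolding s B mult_2 by (simp add: add_ac)
  finally have left: "(\<integral>\<^sup>+ y\<in>{0<..x}. ennreal y * epow (?B y) q \<partial>\<sigma>) \<le> c * (2 * ?B x)"
    by (simp add: mult_left_mono)
  have "(\<integral>\<^sup>+ y\<in>{x<..}. epow (?B y) q \<partial>\<sigma>) \<le>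
    (\<integral>\<^sup>+ y. c * (ennreal (x powr - q) * epow (S x) r + epow (H x) r) * (ennreal (y powr q) * indicator {x<..} y) \<partial>\<sigma>)"
    using epow_bounding_function_right_le[OF x, folded c_def]
    by (intro nn_integral_mono) (auto split: split_indicator)
  also have "\<dots> = c * (ennreal (x powr - q) * epow (S x) r + epow (H x) r) * H x"
    by (simp add: nn_integral_cmult H_def)
  also have "\<dots> = c * (ennreal (x powr - q) * epow (S x) r * H x + epow (H x) r * H x)"
    by (simp add: algebra_simps)
  finally have "ennreal x * (\<integral>\<^sup>+ y\<in>{x<..}. epow (?B y) q \<partial>\<sigma>) \<le>
      ennreal x * (c * (ennreal (x powr - q) * epow (S x) r * H x + epow (H x) r * H x))"
    by (rule mult_left_mono) simp
  also have "\<dots> = c * ((ennreal x * ennreal (x powr - q)) * epow (S x) r * H x + ?k)"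
    by (simp add: k[symmetric] algebra_simps)
  also have "ennreal x * ennreal (x powr - q) = ennreal (x powr (1 - q))"
    using x powr_add[of x 1 "- q"] by (simp flip: ennreal_mult)
  also have "ennreal (x powr (1 - q)) * epow (S x) r * H x = epow ?s q * epow ?k (1 - q)"
    using q x by (simp add: epow_mult epow_epow epow_ennreal mult_ac)
  also have "\<dots> \<le> ?s + ?k"
    using q by (rule epow_young)
  also have "(?s + ?k) + ?k \<le> 2 * ?B x"
    unfolding B mult_2 by (simp add: add_ac)
  finally have right: "ennreal x * (\<integral>\<^sup>+ y\<in>{x<..}. epow (?B y) q \<partial>\<sigma>) \<le> c * (2 * ?B x)"
    by (simp add: mult_left_mono add_mono)
  have "green_potential \<sigma> q ?B x \<le> c * (2 * ?B x) + c * (2 * ?B x)"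
    using x left right by (simp add: green_potential_split add_mono)
  also have "\<dots> = ennreal potential_const * ?B x"
  proof -
    have "ennreal potential_const = 4 * c"
      unfolding potential_const_def c_def by (subst ennreal_mult) auto
    then show ?thesis by (simp add: mult_ac flip: mult_2)
  qed
  finally show ?thesis .
qed

text \<open>At least half of the mass of \<open>y d\<sigma>\<close> on \<open>{0<..x}\<close> sits where \<open>S > S x / 2\<close>.\<close>

lemma green_potential_S_ge:
  assumes x: "0 < x" and fin: "S x < \<infinity>"
  shows "ennreal (2 powr - p) * epow (S x) p \<le> green_potential \<sigma> q (\<lambda>y. epow (S y) p) x"
proof -
  obtain t where t: "S x = ennreal t" "0 \<le> t"
    using fin by (cases "S x") auto
  let ?f = "\<lambda>y. ennreal y * indicator {0<..x} y"
  have G: "(\<integral>\<^sup>+ z\<in>{z. z \<le> y}. ?f z \<partial>\<sigma>) = S y" if "y \<le> x" for y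
    unfolding S_def using that by (intro nn_integral_cong) (auto split: split_indicator)
  let ?low = "\<integral>\<^sup>+ y\<in>{y. S y \<le> ennreal (t / 2)}. ?f y \<partial>\<sigma>"
  let ?high = "\<integral>\<^sup>+ y\<in>{y. ennreal (t / 2) < S y}. ?f y \<partial>\<sigma>"
  have "?low = (\<integral>\<^sup>+ y\<in>{y. (\<integral>\<^sup>+ z\<in>{z. z \<le> y}. ?f z \<partial>\<sigma>) \<le> ennreal (t / 2)}. ?f y \<partial>\<sigma>)"
    by (intro nn_integral_cong) (auto simp: G split: split_indicator)
  also have "\<dots> \<le> ennreal (t / 2)"
    by (rule nn_integral_sublevel_le) measurable
  finally have low: "?low \<le> ennreal (t / 2)" .
  have "ennreal t = (\<integral>\<^sup>+ y. ?f y * indicator {y. S y \<le> ennreal (t / 2)} y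
      + ?f y * indicator {y. ennreal (t / 2) < S y} y \<partial>\<sigma>)"
    unfolding t(1)[symmetric] S_def[of x] by (intro nn_integral_cong) (auto split: split_indicator)
  also have "\<dots> = ?low + ?high"
    by (rule nn_integral_add) measurable
  finally have "ennreal t \<le> ennreal (t / 2) + ?high"
    using low by (simp add: add_right_mono)
  moreover have "ennreal t = ennreal (t / 2) + ennreal (t / 2)"
    using t by (simp flip: ennreal_plus)
  ultimately have high: "ennreal (t / 2) \<le> ?high"
    by (simp add: ennreal_add_left_cancel_le)
  have "ennreal (2 powr - p) * epow (S x) p = ennreal ((t / 2) powr p)"
    using t by (simp add: epow_ennreal powr_divide powr_minus field_simps flip: ennreal_mult)
  \<comment> \<open>The factor with exponent \<open>r\<close> bounds the integrand
    \<open>S^r\<close> from below on the upper set, and the remaining \<open>t / 2\<close> is the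
    mass of that set.\<close>
  also have "\<dots> = ennreal ((t / 2) powr r) * ennreal (t / 2)"
    using t by (simp add: p_eq powr_add flip: ennreal_mult)
  also have "\<dots> \<le> ennreal ((t / 2) powr r) * ?high"
    by (intro mult_left_mono high) simp
  also have "\<dots> = (\<integral>\<^sup>+ y. ennreal ((t / 2) powr r) * (?f y * indicator {y. ennreal (t / 2) < S y} y) \<partial>\<sigma>)"
    by (subst nn_integral_cmult) auto
  also have "\<dots> \<le> green_potential \<sigma> q (\<lambda>y. epow (S y) p) x"
    unfolding green_potential_def
  proof (rule nn_integral_mono)
    fix y
    have "ennreal ((t / 2) powr r) \<le> epow (epow (S y) p) q" if "ennreal (t / 2) < S y"
      using epow_mono[OF r_pos less_imp_le[OF that]] t q by (simp add: epow_ennreal epow_epow)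
    then show "ennreal ((t / 2) powr r) * (?f y * indicator {y. ennreal (t / 2) < S y} y)
      \<le> ennreal (min x y) * epow (epow (S y) p) q"
      by (auto simp: min_def mult.commute intro!: mult_left_mono split: split_indicator)
  qed
  finally show ?thesis .
qed

section \<open>Construction of a solution\<close>

text \<open>\<open>S\<close> may vanish near 0, but the sublevel bound at level 0 shows that
  \<open>y d\<sigma>\<close>, hence \<open>\<sigma>\<close>, does not charge the set where it
  does.\<close>

lemma AE_S_pos: "AE y in \<sigma>. 0 < S y"
proof -
  have "S y = (\<integral>\<^sup>+ z\<in>{z. z \<le> y}. ennreal z \<partial>\<sigma>)" for y
    unfolding S_def by (intro nn_integral_cong) (auto simp: space_sigma split: split_indicator)
  then have "(\<integral>\<^sup>+ y\<in>{y. S y \<le> 0}. ennreal y \<partial>\<sigma>)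
      = (\<integral>\<^sup>+ y\<in>{y. (\<integral>\<^sup>+ z\<in>{z. z \<le> y}. ennreal z \<partial>\<sigma>) \<le> 0}. ennreal y \<partial>\<sigma>)"
    by simp
  also have "\<dots> \<le> 0"
    by (rule nn_integral_sublevel_le) measurable
  finally have "AE y in \<sigma>. ennreal y * indicator {y. S y \<le> 0} y = 0"
    by (subst (asm) le_zero_eq, subst (asm) nn_integral_0_iff_AE) auto
  then show ?thesis
    using AE_space[of \<sigma>]
    by eventually_elim (auto simp: space_sigma zero_less_iff_neq_zero split: split_indicator_asm)
qed

lemma ex_solution_between:
  assumes [measurable]: "w \<in> borel_measurable \<sigma>"
    and sub: "\<And>x. w x \<le> green_potential \<sigma> q w x"
    and super: "\<And>x. green_potential \<sigma> q v x \<le> v x"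
    and le: "\<And>x. w x \<le> v x"
  shows "\<exists>u. u \<in> borel_measurable \<sigma> \<and> (\<forall>x. u x = green_potential \<sigma> q u x \<and> w x \<le> u x \<and> u x \<le> v x)"
proof -
  define U where "U n = ((green_potential \<sigma> q) ^^ n) w" for n
  have U_0: "U 0 = w" and U_Suc: "U (Suc n) = green_potential \<sigma> q (U n)" for n
    by (simp_all add: U_def)
  have [measurable]: "U n \<in> borel_measurable \<sigma>" for n
    by (cases n) (simp_all add: U_0 U_Suc assms(1))
  have U_le_Suc: "U n x \<le> U (Suc n) x" for n x
  proof (induction n arbitrary: x)
    case (Suc n)
    then show ?case unfolding U_Suc[of n] U_Suc[of "Suc n"] by (intro green_potential_mono)
  qed (simp add: U_0 U_Suc sub)
  have U_le: "U n x \<le> v x" for n x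
  proof (induction n arbitrary: x)
    case (Suc n)
    have "U (Suc n) x \<le> green_potential \<sigma> q v x"
      unfolding U_Suc by (intro green_potential_mono Suc)
    also note super
    finally show ?case .
  qed (simp add: U_0 le)
  define u where "u x = (SUP n. U n x)" for x
  \<comment> \<open>Dropping the first term of an increasing sequence keeps its supremum; the
    shifted sequence is the one obtained by applying the potential to each iterate.\<close>
  have u_Suc: "u x = (SUP n. U (Suc n) x)" for x
    unfolding u_def by (intro antisym SUP_mono) (use U_le_Suc in blast)+
  have "green_potential \<sigma> q u x = u x" for x
  proof -
    have "green_potential \<sigma> q u x = (\<integral>\<^sup>+ y. (SUP n. ennreal (min x y) * epow (U n y) q) \<partial>\<sigma>)"
      using q by (simp add: green_potential_def u_def epow_SUP SUP_mult_left_ennreal)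
    also have "\<dots> = (SUP n. \<integral>\<^sup>+ y. ennreal (min x y) * epow (U n y) q \<partial>\<sigma>)"
      using q by (intro nn_integral_monotone_convergence_SUP incseq_SucI le_funI mult_left_mono epow_mono U_le_Suc)
        auto
    also have "\<dots> = (SUP n. U (Suc n) x)"
      by (simp add: U_Suc green_potential_def)
    finally show ?thesis by (simp add: u_Suc)
  qed
  moreover have "w x \<le> u x" for x
    unfolding u_def U_0[symmetric] by (rule SUP_upper) simp
  moreover have "u x \<le> v x" for x
    unfolding u_def by (intro SUP_least U_le)
  moreover have "u \<in> borel_measurable \<sigma>"
    unfolding u_def[abs_def] by measurable
  ultimately show ?thesis by (intro exI[of _ u]) simp
qed

lemma ex_solution_le_bounding_function:
  assumes *: "\<And>a. 0 < a \<Longrightarrow> integrability_condition \<sigma> q a"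
  shows "\<exists>u. positive_solution \<sigma> q u \<and>
    (\<forall>x>0. u x \<le> ennreal (potential_const powr p) * bounding_function \<sigma> q x)"
proof -
  let ?B = "bounding_function \<sigma> q"
  \<comment> \<open>\<open>lam\<close> solves \<open>lam^q * potential_const = lam\<close>, so the
    potential of \<open>lam * B\<close> is at most \<open>lam * B\<close>. Likewise
    \<open>eps\<close> solves \<open>eps^q * 2^-p = eps\<close>, matching the constant of
    \<open>green_potential_S_ge\<close>.\<close>
  define lam where "lam = potential_const powr p"
  define eps where "eps = 2 powr (- p * p)"
  define v where "v x = ennreal lam * ?B x" for x
  define w where "w x = ennreal eps * epow (S x) p" for x
  have [measurable]: "?B \<in> borel_measurable \<sigma>" "S \<in> borel_measurable \<sigma>"
    using measurable_compose[OF measurable_ident_sigma bounding_function_measurable]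
      measurable_compose[OF measurable_ident_sigma S_measurable] by simp_all
  have S_nonpos: "S x = 0" if "x \<le> 0" for x
    using that by (simp add: S_def)
  have fin: "S x < \<infinity>" "H x < \<infinity>" if "0 < x" for x
    using *[OF that] by (simp_all add: integrability_condition_iff)
  have lam: "0 \<le> lam" "lam powr q * potential_const = lam"
  proof -
    have "lam powr q * potential_const = potential_const powr r * potential_const powr 1"
      using potential_const_ge_1 by (simp add: lam_def powr_powr)
    also have "\<dots> = lam"
      by (simp only: lam_def p_eq powr_add)
    finally show "lam powr q * potential_const = lam" .
  qed (simp add: lam_def)
  have eps: "0 < eps" "eps powr q * 2 powr - p = eps"
  proof -
    have "eps powr q * 2 powr - p = 2 powr (- p * p * q + - p)"
      by (simp only: eps_def powr_powr powr_add)
    also have "- p * p * q + - p = - p * (p * q + 1)"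
      by (simp only: algebra_simps)
    also have "\<dots> = - p * p"
      by (simp only: p_mult flip: p_eq)
    finally show "eps powr q * 2 powr - p = eps" by (simp only: eps_def)
  qed (simp add: eps_def)
  have "eps \<le> lam"
  proof -
    have "eps \<le> 2 powr 0" unfolding eps_def by (intro powr_mono) auto
    also have "\<dots> \<le> lam" using potential_const_ge_1 p_pos by (simp add: lam_def ge_one_powr_ge_zero)
    finally show ?thesis .
  qed
  have "\<exists>u. u \<in> borel_measurable \<sigma> \<and> (\<forall>x. u x = green_potential \<sigma> q u x \<and> w x \<le> u x \<and> u x \<le> v x)"
  proof (rule ex_solution_between)
    show "w \<in> borel_measurable \<sigma>"
      unfolding w_def[abs_def] by measurable
    show "w x \<le> v x" for x
      unfolding w_def v_def bounding_function_eq using \<open>eps \<le> lam\<close>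
      by (intro mult_mono ennreal_leI) auto
    show "green_potential \<sigma> q v x \<le> v x" for x
    proof (cases "0 < x")
      case True
      have "green_potential \<sigma> q v x = ennreal (lam powr q) * green_potential \<sigma> q ?B x"
        unfolding v_def[abs_def] by (intro green_potential_cmult lam) measurable
      also have "\<dots> \<le> ennreal (lam powr q) * (ennreal potential_const * ?B x)"
        by (intro mult_left_mono green_potential_bounding_function_le True) simp
      also have "\<dots> = ennreal (lam powr q * potential_const) * ?B x"
        using potential_const_ge_1 by (simp add: ennreal_mult mult.assoc)
      also have "\<dots> = v x"
        by (simp add: lam v_def)
      finally show ?thesis .
    qed (simp add: green_potential_nonpos)
    show "w x \<le> green_potential \<sigma> q w x" for x
    proof (cases "0 < x")
      case True
      have "w x = ennreal (eps powr q) * (ennreal (2 powr - p) * epow (S x) p)"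
        unfolding w_def mult.assoc[symmetric] ennreal_mult[OF powr_ge_zero powr_ge_zero, symmetric] eps(2) ..
      also have "\<dots> \<le> ennreal (eps powr q) * green_potential \<sigma> q (\<lambda>y. epow (S y) p) x"
        by (intro mult_left_mono green_potential_S_ge True fin) simp
      also have "\<dots> = green_potential \<sigma> q w x"
        unfolding w_def[abs_def] using eps by (intro green_potential_cmult[symmetric]) auto
      finally show ?thesis .
    qed (simp add: w_def S_nonpos)
  qed
  then obtain u where [measurable]: "u \<in> borel_measurable \<sigma>"
    and u: "\<And>x. u x = green_potential \<sigma> q u x" "\<And>x. w x \<le> u x" "\<And>x. u x \<le> v x"
    by blast
  have u_fin: "u x < \<infinity>" if "0 < x" for x
  proof (rule le_less_trans[OF u(3)])
    show "v x < \<infinity>"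
      using fin[OF that] by (simp add: v_def bounding_function_eq ennreal_mult_less_top)
  qed
  have "admissible \<sigma> q u"
    unfolding admissible_def
  proof (intro conjI allI impI)
    show "AE x in \<sigma>. 0 < u x \<and> u x < \<infinity>"
      using AE_S_pos AE_space[of \<sigma>]
    proof eventually_elim
      case (elim x)
      then have "0 < w x" using eps by (simp add: w_def ennreal_zero_less_mult_iff)
      then show ?case using u(2)[of x] u_fin[of x] elim by (auto simp: space_sigma)
    qed
    fix a :: real assume a: "0 < a"
    \<comment> \<open>Both integrals required by admissibility are pieces of the potential at
      \<open>a\<close>, which equals the finite value \<open>u a\<close>.\<close>
    have "(\<integral>\<^sup>+ y\<in>{0<..a}. ennreal y * epow (u y) q \<partial>\<sigma>) + ennreal a * (\<integral>\<^sup>+ y\<in>{a<..}. epow (u y) q \<partial>\<sigma>) < \<infinity>"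
      using u_fin[OF a] u(1)[of a] green_potential_split[of u a] a by simp
    then show "(\<integral>\<^sup>+ y\<in>{0<..a}. ennreal y * epow (u y) q \<partial>\<sigma>) < \<infinity>"
      and "(\<integral>\<^sup>+ y\<in>{a<..}. epow (u y) q \<partial>\<sigma>) < \<infinity>"
      using a by (auto simp: ennreal_mult_less_top)
  qed measurable
  then have "positive_solution \<sigma> q u"
    using u(1) by (simp add: positive_solution_def)
  with u(3) show ?thesis unfolding v_def lam_def by blast
qed

end

section \<open>Assembling the equivalence and the two-sided bounds\<close>

lemma ennreal_inverse_mult_le:
  assumes "0 < C" "s \<le> ennreal C * t"
  shows "ennreal (inverse C) * s \<le> t"
proof -
  have "ennreal (inverse C) * s \<le> ennreal (inverse C) * (ennreal C * t)"
    by (intro mult_left_mono assms) simp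
  also have "\<dots> = t"
    using assms(1) by (simp flip: mult.assoc ennreal_mult)
  finally show ?thesis .
qed

theorem theorem2p8:
  fixes \<sigma> :: "real measure" and q :: real
  assumes "locally_finite_borel_measure \<sigma>"
    and "0 < q" and "q < 1"
  shows "((\<exists>u. positive_solution \<sigma> q u) \<longleftrightarrow> (\<forall>a>0. integrability_condition \<sigma> q a)) \<and>
    (\<exists>C::real. C > 0 \<and>
      ((\<forall>a>0. integrability_condition \<sigma> q a) \<longrightarrow>
        (\<exists>u. positive_solution \<sigma> q u \<and>
          (\<forall>x>0. ennreal (inverse C) * bounding_function \<sigma> q x \<le> u x \<and>
                 u x \<le> ennreal C * bounding_function \<sigma> q x))) \<and>
      (\<forall>u. positive_supersolution \<sigma> q u \<longrightarrow>
        (\<forall>x>0. ennreal (inverse C) * bounding_function \<sigma> q x \<le> u x)))"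
proof -
  interpret half_line_measure \<sigma> q
    using assms by unfold_locales (auto simp: locally_finite_borel_measure_def)
  \<comment> \<open>One constant, depending on \<open>q\<close> alone, has to serve the upper bound
    of the constructed solution and the lower bound of every supersolution.\<close>
  define C where "C = max (potential_const powr p) (dyadic_const q powr p)"
  have C: "0 < C" "potential_const powr p \<le> C" "dyadic_const q powr p \<le> C"
    using potential_const_ge_1 by (auto simp: C_def less_max_iff_disj)
  have solution: "positive_supersolution \<sigma> q u" if "positive_solution \<sigma> q u" for u
    using that by (simp add: positive_solution_def positive_supersolution_def)
  have lower: "ennreal (inverse C) * bounding_function \<sigma> q x \<le> u x"
    if "positive_supersolution \<sigma> q u" "0 < x" for u x
  proof (rule ennreal_inverse_mult_le[OF C(1)])
    show "bounding_function \<sigma> q x \<le> ennreal C * u x"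
      by (rule order_trans[OF bounding_function_le_supersolution[OF that]])
        (intro mult_right_mono ennreal_leI C zero_le)
  qed
  have upper: "\<exists>u. positive_solution \<sigma> q u \<and> (\<forall>x>0. u x \<le> ennreal C * bounding_function \<sigma> q x)"
    if cond: "\<forall>a>0. integrability_condition \<sigma> q a"
  proof -
    obtain u where u: "positive_solution \<sigma> q u"
      "\<And>x. 0 < x \<Longrightarrow> u x \<le> ennreal (potential_const powr p) * bounding_function \<sigma> q x"
      using ex_solution_le_bounding_function[OF cond[rule_format]] by blast
    have "u x \<le> ennreal C * bounding_function \<sigma> q x" if "0 < x" for x
      by (rule order_trans[OF u(2)[OF that]]) (intro mult_right_mono ennreal_leI C zero_le)
    with u(1) show ?thesis by blast
  qed
  show ?thesis
    using C(1) solution lower upper supersolution_integrability_condition by blast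
qed

end
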